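(* Let $k \geq 1$, let $A \in \mathbb{R}^{m \times n}$ satisfy $\mathrm{rank}(A) > k$, and let $X \in \mathbb{R}^{n \times q}$ have full column rank with $q \le n-1$. Let $\widehat{S} \subset \{1, \dots, n\}$, $|\widehat{S}| = k$, satisfy $\mathrm{vol}(A_{\widehat{S}}) > 0$. Then, for every $\gamma \ge 1$, there exists a matrix $B \in \mathbb{R}^{m\times n}$, $B \ne A$, such that $BX = AX$, but $\widehat{S}$ is not a $\gamma$-local maximum-volume subset of $B$. More precisely, there exists a one-swap neighbor $T \in \mathcal{N}_1(\widehat{S})$ such that $$\mathrm{vol}(B_T) > \gamma \cdot \mathrm{vol}(B_{\widehat{S}}).$$
   Context: For $S \subset \{1,\dots,n\}$ with $|S| = k$, write $A_S = A_{:,S}$ for the submatrix of $A$ consisting of the columns indexed by $S$, and $\mathrm{vol}(A_S) = \prod_{\ell=1}^k \sigma_\ell(A_S) = \det(A_S^\top A_S)^{1/2}$, where $\sigma_\ell$ denotes singular values. The one-swap neighborhood of $S$ is $\mathcal{N}_1(S) = \{(S \setminus \{i\}) \cup \{j\} : i \in S,\ j \notin S\}$ (with $j \in \{1,\dots,n\}$). For $\gamma \ge 1$, a size-$k$ set $S$ is a $\gamma$-local maximum-volume subset of $A$ if $\mathrm{vol}(A_T) \le \gamma \cdot \mathrm{vol}(A_S)$ for every $T \in \mathcal{N}_1(S)$. *)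

theory Defs
  imports
    Complex_Main
    "Jordan_Normal_Form.DL_Submatrix"
    "Jordan_Normal_Form.DL_Rank"
    "Jordan_Normal_Form.Schur_Decomposition"
begin

text \<open>
  Rows and columns are numbered from 0, so the column index set \<open>{1,...,n}\<close> of the literature
  is \<open>{..<dim_col A}\<close> here.
\<close>

definition col_submatrix :: "'a mat \<Rightarrow> nat set \<Rightarrow> 'a mat" where
  "col_submatrix A S = submatrix A UNIV S"

definition vol :: "real mat \<Rightarrow> real" where
  "vol M = sqrt (det (transpose_mat M * M))"

text \<open>
  The volume is the product of the singular values, that is, of the square roots \<open>\<sigma>\<close> of the
  eigenvalues of the Gram matrix, counted with multiplicity.
\<close>

lemma vol_eq_prod_singular_values:
  assumes char: "char_poly (transpose_mat M * M) = (\<Prod>s\<leftarrow>\<sigma>s. [:- (s\<^sup>2), 1:])"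
    and nonneg: "\<And>s. s \<in> set \<sigma>s \<Longrightarrow> 0 \<le> s"
  shows "vol M = prod_list \<sigma>s"
proof -
  let ?G = "transpose_mat M * M" and ?k = "dim_col M"
  have G: "?G \<in> carrier_mat ?k ?k" by (rule mult_carrier_mat[of _ _ "dim_row M"]) simp_all
  define es where "es = map (\<lambda>s. s\<^sup>2) \<sigma>s"
  have cp: "char_poly ?G = (\<Prod>e\<leftarrow>es. [:- e, 1:])"
    unfolding char es_def by (simp add: comp_def)
  obtain B P Q where dec: "schur_decomposition ?G es = (B, P, Q)"
    by (rule prod_cases3)
  note schur = schur_decomposition[OF G cp dec]
  have sim: "similar_mat ?G B"
    unfolding similar_mat_def using schur by (intro exI) (rule conjunct1)
  have B: "B \<in> carrier_mat ?k ?k"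
    by (rule similar_mat_witD2(5)[OF G conjunct1[OF schur]])
  have "det ?G = det B"
    by (rule det_similar[OF sim])
  also have "\<dots> = prod_list (diag_mat B)"
    by (rule det_upper_triangular[OF conjunct1[OF conjunct2[OF schur]] B])
  also have "\<dots> = prod_list es"
    by (simp only: conjunct2[OF conjunct2[OF schur]])
  also have "\<dots> = (prod_list \<sigma>s)\<^sup>2"
    unfolding es_def by (induction \<sigma>s) (simp_all add: power_mult_distrib)
  finally have "det ?G = (prod_list \<sigma>s)\<^sup>2" .
  moreover have "0 \<le> prod_list \<sigma>s"
    using nonneg by (induction \<sigma>s) simp_all
  ultimately show ?thesis
    unfolding vol_def by (simp only: real_sqrt_abs abs_of_nonneg)
qed

definition one_swap_nbhd :: "nat \<Rightarrow> nat set \<Rightarrow> nat set set" where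
  "one_swap_nbhd n S = {insert j (S - {i}) | i j. i \<in> S \<and> j \<in> {..<n} - S}"

definition local_max_vol_subset :: "nat \<Rightarrow> real \<Rightarrow> real mat \<Rightarrow> nat set \<Rightarrow> bool" where
  "local_max_vol_subset k \<gamma> A S \<longleftrightarrow>
     S \<subseteq> {..<dim_col A} \<and> card S = k \<and>
     (\<forall>T \<in> one_swap_nbhd (dim_col A) S.
        vol (col_submatrix A T) \<le> \<gamma> * vol (col_submatrix A S))"

text \<open>
  \<^const>\<open>vec_space.rank\<close> takes the ambient dimension, i.e. the number of rows, explicitly.
\<close>

abbreviation mat_rank :: "real mat \<Rightarrow> nat" where
  "mat_rank A \<equiv> vec_space.rank (dim_row A) A"

end

theory Submission
  imports Defs
begin

text \<open>
  Since \<open>q < n\<close> there is \<open>z \<noteq> 0\<close> with \<open>X\<^sup>T z = 0\<close>, so every \<open>B = A + u z\<^sup>T\<close> satisfies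
  \<open>B X = A X\<close>; since \<open>rank A > k\<close>, some column \<open>a\<^sub>j\<close> is independent of the columns in \<open>S\<close>.
  If \<open>z\<^sub>i \<noteq> 0\<close> for some \<open>i \<in> S\<close>, then \<open>u = - a\<^sub>i / z\<^sub>i\<close> makes column \<open>i\<close> of \<open>B\<close> vanish, so that
  \<open>vol (B\<^sub>S) = 0\<close>, while exchanging \<open>i\<close> for \<open>j\<close> gives independent columns.
  Otherwise \<open>B\<^sub>S = A\<^sub>S\<close> for every \<open>u\<close>, and for \<open>p\<close> with \<open>z\<^sub>p \<noteq> 0\<close> one can turn column \<open>p\<close> into an
  arbitrarily large multiple of \<open>a\<^sub>j\<close>, so that exchanging any \<open>i \<in> S\<close> for \<open>p\<close> gives an arbitrarily
  large volume.
\<close>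

section \<open>Gram determinants and volumes of real matrices\<close>

lemma gram_carrier: "transpose_mat M * M \<in> carrier_mat (dim_col M) (dim_col M)"
  by (rule mult_carrier_mat[of _ _ "dim_row M"]) simp_all

lemma gram_mult_vec:
  fixes M :: "'a :: comm_ring_1 mat"
  assumes "M \<in> carrier_mat m k" "v \<in> carrier_vec k"
  shows "(transpose_mat M * M) *\<^sub>v v = transpose_mat M *\<^sub>v (M *\<^sub>v v)"
  using assms by (intro assoc_mult_mat_vec) auto

lemma scalar_prod_gram:
  fixes M :: "real mat"
  assumes M: "M \<in> carrier_mat m k" and v: "v \<in> carrier_vec k"
  shows "v \<bullet> ((transpose_mat M * M) *\<^sub>v v) = (M *\<^sub>v v) \<bullet> (M *\<^sub>v v)"
proof -
  have "v \<bullet> ((transpose_mat M * M) *\<^sub>v v) = (transpose_mat M *\<^sub>v (M *\<^sub>v v)) \<bullet> v"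
    unfolding gram_mult_vec[OF M v] by (rule comm_scalar_prod[OF v]) (use M v in auto)
  also have "\<dots> = (M *\<^sub>v v) \<bullet> (M *\<^sub>v v)"
    by (rule transpose_vec_mult_scalar[OF M v]) (use M v in auto)
  finally show ?thesis .
qed

lemma scalar_prod_self_ge_0: "0 \<le> (v :: real vec) \<bullet> v"
  by (simp add: scalar_prod_def sum_nonneg)

lemma scalar_prod_self_eq_0D:
  fixes v :: "real vec"
  assumes "v \<bullet> v = 0"
  shows "v = 0\<^sub>v (dim_vec v)"
proof (rule eq_vecI)
  have "\<forall>i\<in>{0..<dim_vec v}. v $ i * v $ i = 0"
    using assms by (subst (asm) scalar_prod_def, subst (asm) sum_nonneg_eq_0_iff) auto
  then show "v $ i = 0\<^sub>v (dim_vec v) $ i" if "i < dim_vec (0\<^sub>v (dim_vec v))" for i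
    using that by simp
qed simp

text \<open>Over the reals \<open>M\<close> and its Gram matrix \<open>G\<close> have the same
  kernel: \<open>G v = 0\<close> gives (M v) . (M v) = v . (G v) = 0, and a sum of squares vanishes
  only if every term does.\<close>

lemma det_gram_eq_0_iff:
  fixes M :: "real mat"
  shows "det (transpose_mat M * M) = 0 \<longleftrightarrow>
    (\<exists>v \<in> carrier_vec (dim_col M). v \<noteq> 0\<^sub>v (dim_col M) \<and> M *\<^sub>v v = 0\<^sub>v (dim_row M))"
proof -
  have "(transpose_mat M * M) *\<^sub>v v = 0\<^sub>v (dim_col M) \<longleftrightarrow> M *\<^sub>v v = 0\<^sub>v (dim_row M)"
    if v: "v \<in> carrier_vec (dim_col M)" for v
  proof
    assume "(transpose_mat M * M) *\<^sub>v v = 0\<^sub>v (dim_col M)"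
    then have "(M *\<^sub>v v) \<bullet> (M *\<^sub>v v) = 0"
      using scalar_prod_gram[OF carrier_matI[OF refl refl] v] v by simp
    from scalar_prod_self_eq_0D[OF this] show "M *\<^sub>v v = 0\<^sub>v (dim_row M)" by simp
  next
    assume "M *\<^sub>v v = 0\<^sub>v (dim_row M)"
    then show "(transpose_mat M * M) *\<^sub>v v = 0\<^sub>v (dim_col M)"
      unfolding gram_mult_vec[OF carrier_matI[OF refl refl] v]
      by (auto simp: scalar_prod_def)
  qed
  then show ?thesis
    unfolding det_0_iff_vec_prod_zero_field[OF gram_carrier] by blast
qed

text \<open>
  The polynomial \<open>det (t I + M\<^sup>T M)\<close> is monic and has no root \<open>t > 0\<close>, hence it is
  nonnegative at \<open>t = 0\<close>.
\<close>

lemma det_gram_nonneg: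
  fixes M :: "real mat"
  shows "0 \<le> det (transpose_mat M * M)"
proof (rule ccontr)
  assume neg: "\<not> 0 \<le> det (transpose_mat M * M)"
  define G where "G = transpose_mat M * M"
  define k where "k = dim_col M"
  define p where "p = char_poly (- G)"
  have G: "G \<in> carrier_mat k k"
    unfolding G_def k_def by (rule gram_carrier)
  have p0: "poly p 0 = det G"
    unfolding p_def char_poly_def
    by (rule poly_det_cong[OF G]) (use G in \<open>auto simp: char_poly_matrix_def\<close>)
  have "lead_coeff p = 1"
    using degree_monic_char_poly[of "- G" k] G unfolding p_def by simp
  then obtain N where N: "\<And>x. x \<ge> N \<Longrightarrow> poly p x \<ge> 1"
    using poly_pinfty_gt_lc[of p] by auto
  have "poly p (max N 1) > 0" using N[of "max N 1"] by simp
  moreover have "poly p 0 < 0" using p0 neg G_def by simp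
  ultimately have "\<exists>t>0. t < max N 1 \<and> poly p t = 0"
    by (intro poly_IVT_pos) simp_all
  then obtain t where t: "t > 0" "poly p t = 0" by blast
  then have "eigenvalue (- G) t"
    unfolding p_def using eigenvalue_root_char_poly[of "- G" k] G by simp
  then obtain v where v: "v \<in> carrier_vec k" "v \<noteq> 0\<^sub>v k" "- G *\<^sub>v v = t \<cdot>\<^sub>v v"
    unfolding eigenvalue_def eigenvector_def using G by auto
  \<comment> \<open>Pairing the eigenvector equation with \<open>v\<close> gives t (v . v) = - (M v)
    . (M v), which is impossible for t > 0 and \<open>v\<close> nonzero.\<close>
  have "t * (v \<bullet> v) = v \<bullet> (- G *\<^sub>v v)" using v by simp
  also have "- G *\<^sub>v v = - (G *\<^sub>v v)" using v(1) G by simp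
  also have "v \<bullet> - (G *\<^sub>v v) = - (v \<bullet> (G *\<^sub>v v))" using v(1) G by simp
  also have "\<dots> \<le> 0"
    using scalar_prod_gram[OF carrier_matI[OF refl refl] v(1)[unfolded k_def]]
      scalar_prod_self_ge_0[of "M *\<^sub>v v"] unfolding G_def by linarith
  finally have "v \<bullet> v \<le> 0" using t by (simp add: mult_le_0_iff)
  then have "v \<bullet> v = 0" using scalar_prod_self_ge_0[of v] by simp
  from scalar_prod_self_eq_0D[OF this] v show False by simp
qed

lemma vol_nonneg: "0 \<le> vol M"
  unfolding vol_def by (simp add: det_gram_nonneg)

lemma vol_pos_iff:
  "0 < vol M \<longleftrightarrow>
    (\<forall>v \<in> carrier_vec (dim_col M). M *\<^sub>v v = 0\<^sub>v (dim_row M) \<longrightarrow> v = 0\<^sub>v (dim_col M))"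
  using det_gram_nonneg[of M] det_gram_eq_0_iff[of M] unfolding vol_def real_sqrt_gt_0_iff
  by fastforce

text \<open>Scaling a column is right multiplication by an elementary matrix \<open>E\<close> of
  determinant \<open>c\<close>. The Gram determinant picks up \<open>det E\<close> twice, and the
  square root of c^2 is |c|.\<close>

lemma vol_multcol:
  assumes M: "M \<in> carrier_mat m k" and j: "j < k"
  shows "vol (multcol j c M) = \<bar>c\<bar> * vol M"
proof -
  define E where "E = multrow_mat k j c"
  have E: "E \<in> carrier_mat k k" by (simp add: E_def)
  have detE: "det E = c" unfolding E_def by (rule det_multrow_mat) (rule j)
  have G: "transpose_mat M * M \<in> carrier_mat k k"
    using gram_carrier[of M] M by simp
  have "transpose_mat (M * E) * (M * E) = (transpose_mat E * transpose_mat M) * (M * E)"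
    using transpose_mult[OF M E] by simp
  also have "\<dots> = transpose_mat E * (transpose_mat M * (M * E))"
    by (rule assoc_mult_mat[of _ k k _ m _ k]) (use M E in auto)
  also have "\<dots> = transpose_mat E * ((transpose_mat M * M) * E)"
    using assoc_mult_mat[of "transpose_mat M" k m M k E k] M E by simp
  finally have "transpose_mat (M * E) * (M * E)
      = transpose_mat E * ((transpose_mat M * M) * E)" .
  then have "det (transpose_mat (M * E) * (M * E)) = c * (det (transpose_mat M * M) * c)"
    using E G detE by (simp add: det_mult[of _ k] det_transpose[OF E])
  also have "\<dots> = c\<^sup>2 * det (transpose_mat M * M)" by (simp add: power2_eq_square)
  finally show ?thesis
    unfolding vol_def multcol_mat[OF M] E_def[symmetric] by (simp add: real_sqrt_mult)
qed

section \<open>Column submatrices and independence of selected columns\<close>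

lemma col_submatrix_dim:
  assumes "B \<in> carrier_mat m n" "S \<subseteq> {..<n}"
  shows "dim_row (col_submatrix B S) = m" "dim_col (col_submatrix B S) = card S"
proof -
  have "{j. j < n \<and> j \<in> S} = S" using assms by auto
  then show "dim_row (col_submatrix B S) = m" "dim_col (col_submatrix B S) = card S"
    using assms by (auto simp: col_submatrix_def dim_submatrix)
qed

lemma col_submatrix_index:
  assumes "B \<in> carrier_mat m n" "S \<subseteq> {..<n}" "r < m" "j < card S"
  shows "col_submatrix B S $$ (r, j) = B $$ (r, pick S j)"
proof -
  have "{j. j < n \<and> j \<in> S} = S" using assms by auto
  then show ?thesis
    using assms by (auto simp: col_submatrix_def submatrix_index pick_UNIV)
qed

lemma col_submatrix_cong:
  assumes "B \<in> carrier_mat m n" "C \<in> carrier_mat m n" "S \<subseteq> {..<n}"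
    and "\<And>r l. r < m \<Longrightarrow> l \<in> S \<Longrightarrow> B $$ (r, l) = C $$ (r, l)"
  shows "col_submatrix B S = col_submatrix C S"
  by (rule eq_matI)
    (use assms in \<open>auto simp: col_submatrix_dim col_submatrix_index pick_in_set\<close>)

lemma card_less_mem:
  fixes p :: nat
  assumes "finite S" "p \<in> S"
  shows "card {a \<in> S. a < p} < card S"
  using assms by (intro psubset_card_mono) auto

lemma col_submatrix_multcol:
  assumes "B \<in> carrier_mat m n" "S \<subseteq> {..<n}" "p \<in> S"
  shows "col_submatrix (multcol p c B) S
    = multcol (card {a \<in> S. a < p}) c (col_submatrix B S)"
proof -
  have mB: "multcol p c B \<in> carrier_mat m n"
    using assms(1) by auto
  have "pick S j < n" if "j < card S" for j
    using pick_in_set[of j S] that assms(2) by auto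
  then show ?thesis
    by (intro eq_matI)
      (use assms in \<open>auto simp: col_submatrix_dim[OF mB] col_submatrix_index[OF mB]
        col_submatrix_dim col_submatrix_index pick_card_in_set card_pick\<close>)
qed

lemma vol_col_submatrix_multcol:
  assumes "B \<in> carrier_mat m n" "S \<subseteq> {..<n}" "p \<in> S"
  shows "vol (col_submatrix (multcol p c B) S) = \<bar>c\<bar> * vol (col_submatrix B S)"
proof -
  have "finite S" using assms(2) finite_subset by blast
  moreover have "col_submatrix B S \<in> carrier_mat m (card S)"
    by (rule carrier_matI) (simp_all add: col_submatrix_dim[OF assms(1,2)])
  ultimately show ?thesis
    unfolding col_submatrix_multcol[OF assms] using card_less_mem assms(3)
    by (intro vol_multcol) auto
qed

lemma col_submatrix_mult_vec:
  fixes B :: "real mat"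
  assumes "B \<in> carrier_mat m n" "S \<subseteq> {..<n}"
  shows "col_submatrix B S *\<^sub>v vec (card S) (\<lambda>j. c (pick S j))
    = vec m (\<lambda>r. \<Sum>l\<in>S. c l * B $$ (r, l))"
proof (rule eq_vecI)
  fix r assume "r < dim_vec (vec m (\<lambda>r. \<Sum>l\<in>S. c l * B $$ (r, l)))"
  then have r: "r < m" by simp
  have fin: "finite S" using assms(2) finite_subset by blast
  have "(col_submatrix B S *\<^sub>v vec (card S) (\<lambda>j. c (pick S j))) $ r
      = (\<Sum>j\<in>{0..<card S}. B $$ (r, pick S j) * c (pick S j))"
    using r assms by (auto simp: col_submatrix_dim col_submatrix_index scalar_prod_def)
  \<comment> \<open>The position of a column \<open>l\<close> inside the submatrix is the number of
    elements of \<open>S\<close> below \<open>l\<close>; this map is inverse to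
    \<open>pick S\<close>.\<close>
  also have "\<dots> = (\<Sum>l\<in>S. c l * B $$ (r, l))"
    by (rule sum.reindex_bij_witness[where i = "\<lambda>l. card {a \<in> S. a < l}" and j = "pick S"])
      (use fin in \<open>auto simp: card_pick pick_card_in_set pick_in_set card_less_mem mult.commute\<close>)
  finally show "(col_submatrix B S *\<^sub>v vec (card S) (\<lambda>j. c (pick S j))) $ r
      = vec m (\<lambda>r. \<Sum>l\<in>S. c l * B $$ (r, l)) $ r"
    using r by simp
qed (use assms in \<open>simp add: col_submatrix_dim\<close>)

text \<open>Indexing the coefficients by the original column numbers makes independence of the
  columns of different sets \<open>S\<close> comparable without tracking how positions shift under a
  swap. All later volume positivity arguments go through this form.\<close>

lemma vol_col_submatrix_pos_iff:
  assumes B: "B \<in> carrier_mat m n" and S: "S \<subseteq> {..<n}"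
  shows "0 < vol (col_submatrix B S) \<longleftrightarrow>
    (\<forall>c. (\<forall>r<m. (\<Sum>l\<in>S. c l * B $$ (r, l)) = 0) \<longrightarrow> (\<forall>l\<in>S. c l = 0))"
    (is "_ \<longleftrightarrow> ?indep")
proof
  assume pos: "0 < vol (col_submatrix B S)"
  have fin: "finite S" using S finite_subset by blast
  show ?indep
  proof (intro allI impI ballI)
    fix c l assume c: "\<forall>r<m. (\<Sum>l\<in>S. c l * B $$ (r, l)) = 0" and l: "l \<in> S"
    let ?v = "vec (card S) (\<lambda>j. c (pick S j))"
    have "col_submatrix B S *\<^sub>v ?v = 0\<^sub>v m"
      unfolding col_submatrix_mult_vec[OF B S] using c by auto
    then have "?v = 0\<^sub>v (card S)"
      using pos unfolding vol_pos_iff by (simp add: col_submatrix_dim[OF B S])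
    then have "?v $ card {a \<in> S. a < l} = 0"
      using card_less_mem[OF fin l] by simp
    then show "c l = 0"
      using card_less_mem[OF fin l] pick_card_in_set[OF l] by simp
  qed
next
  assume indep: ?indep
  show "0 < vol (col_submatrix B S)"
    unfolding vol_pos_iff col_submatrix_dim[OF B S]
  proof (intro ballI impI)
    fix v assume v: "v \<in> carrier_vec (card S)" and Bv: "col_submatrix B S *\<^sub>v v = 0\<^sub>v m"
    define c where "c l = v $ card {a \<in> S. a < l}" for l
    have v_eq: "v = vec (card S) (\<lambda>j. c (pick S j))"
      using v by (auto simp: c_def card_pick)
    have "vec m (\<lambda>r. \<Sum>l\<in>S. c l * B $$ (r, l)) = 0\<^sub>v m"
      using col_submatrix_mult_vec[OF B S, of c] Bv v_eq by simp
    then have "\<forall>r<m. vec m (\<lambda>r. \<Sum>l\<in>S. c l * B $$ (r, l)) $ r = 0" by simp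
    then have "\<forall>r<m. (\<Sum>l\<in>S. c l * B $$ (r, l)) = 0" by simp
    then have "\<forall>l\<in>S. c l = 0" using indep by blast
    then show "v = 0\<^sub>v (card S)"
      by (subst v_eq) (auto simp: pick_in_set)
  qed
qed

section \<open>Rank, span and an additional independent column\<close>

context vec_space
begin

text \<open>A maximal independent set of columns has as many elements as the rank, and the exchange
  lemma bounds its size by that of any finite set whose span contains it.\<close>

lemma rank_le_card_span:
  assumes A: "A \<in> carrier_mat n nc" and U: "finite U" "U \<subseteq> carrier_vec n"
    and span: "set (cols A) \<subseteq> span U"
  shows "rank A \<le> card U"
proof -
  have "\<exists>W. finite W \<and> maximal W (\<lambda>T. T \<subseteq> set (cols A) \<and> lin_indpt T) \<and> {} \<subseteq> W"
    by (rule maximal_exists_superset[of "set (cols A)"]) (auto simp: lin_dep_def)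
  then obtain W where W: "finite W" "maximal W (\<lambda>T. T \<subseteq> set (cols A) \<and> lin_indpt T)"
    by blast
  then have sub: "W \<subseteq> set (cols A)" and li: "lin_indpt W" by (auto simp: maximal_def)
  have "W \<subseteq> span U" using sub span by blast
  then obtain C :: "'a vec set" where "int (card C) \<le> int (card U) - int (card W)"
    using replacement[OF W(1) U(1) _ li] U(2) by auto
  then have "card W \<le> card U" by simp
  then show ?thesis using rank_card_indpt[OF A W(2)] by simp
qed

text \<open>The sum runs over indices rather than vectors, so \<open>u\<close> may repeat vectors,
  as the columns of a matrix can.\<close>

lemma sum_in_span:
  assumes "finite S" "U \<subseteq> carrier_vec n" "\<And>i. i \<in> S \<Longrightarrow> u i \<in> U"
  shows "vec n (\<lambda>r. \<Sum>i\<in>S. c i * u i $ r) \<in> span U"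
  using assms(1,3)
proof (induction S rule: finite_induct)
  case empty
  have "vec n (\<lambda>r. \<Sum>i\<in>{}. c i * u i $ r) = sumlist []" by auto
  then show ?case using sumlist_in_span[OF assms(2), of "[]"] by simp
next
  case (insert x S)
  have x: "u x \<in> U" "u x \<in> carrier_vec n" using insert.prems assms(2) by auto
  have eq: "vec n (\<lambda>r. \<Sum>i\<in>insert x S. c i * u i $ r)
      = c x \<cdot>\<^sub>v u x + vec n (\<lambda>r. \<Sum>i\<in>S. c i * u i $ r)"
  proof (rule eq_vecI)
    fix r assume "r < dim_vec (c x \<cdot>\<^sub>v u x + vec n (\<lambda>r. \<Sum>i\<in>S. c i * u i $ r))"
    then show "vec n (\<lambda>r. \<Sum>i\<in>insert x S. c i * u i $ r) $ r
        = (c x \<cdot>\<^sub>v u x + vec n (\<lambda>r. \<Sum>i\<in>S. c i * u i $ r)) $ r"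
      using insert.hyps x(2) by simp
  qed simp
  have cx: "c x \<cdot>\<^sub>v u x \<in> span U"
    by (rule smult_in_span[OF assms(2) span_mem[OF assms(2) x(1)]])
  have "vec n (\<lambda>r. \<Sum>i\<in>S. c i * u i $ r) \<in> span U"
    using insert.IH insert.prems by blast
  from span_add1[OF assms(2) cx this] show ?case
    unfolding eq by simp
qed

end

lemma obtain_col_extending_basis:
  fixes A :: "real mat"
  assumes A: "A \<in> carrier_mat m n" and S: "S \<subseteq> {..<n}"
    and rank: "mat_rank A > card S" and pos: "0 < vol (col_submatrix A S)"
  obtains j where "j \<in> {..<n} - S" "0 < vol (col_submatrix A (insert j S))"
proof -
  interpret V: vec_space "TYPE(real)" m .
  have fin: "finite S" using S finite_subset by blast
  let ?U = "col A ` S"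
  have U: "finite ?U" "?U \<subseteq> carrier_vec m" using fin A by auto
  \<comment> \<open>Otherwise the rank would be at most the number of distinct columns indexed by
    \<open>S\<close>, hence at most \<open>card S\<close>.\<close>
  have "\<not> set (cols A) \<subseteq> V.span ?U"
    using V.rank_le_card_span[OF A U] rank card_image_le[OF fin, of "col A"] A by auto
  then obtain j where j: "j < n" "col A j \<notin> V.span ?U"
    using A unfolding cols_def by fastforce
  have "j \<notin> S" using j V.span_mem[OF U(2)] by blast
  have "0 < vol (col_submatrix A (insert j S))"
  proof (subst vol_col_submatrix_pos_iff[OF A], use S j in simp, intro allI impI)
    fix c assume c: "\<forall>r<m. (\<Sum>l\<in>insert j S. c l * A $$ (r, l)) = 0"
    have eq: "c j * A $$ (r, j) + (\<Sum>l\<in>S. c l * A $$ (r, l)) = 0" if "r < m" for r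
      using c that fin \<open>j \<notin> S\<close> by simp
    \<comment> \<open>If not, solving the relation for column \<open>j\<close> would put it into the
      span of the columns in \<open>S\<close>. Once \<open>c j = 0\<close>, the relation involves
      only \<open>S\<close>.\<close>
    have "c j = 0"
    proof (rule ccontr)
      assume cj: "c j \<noteq> 0"
      have "col A j $ r = (\<Sum>l\<in>S. (- c l / c j) * col A l $ r)" if r: "r < m" for r
      proof -
        have "(\<Sum>l\<in>S. (- c l / c j) * col A l $ r) = (\<Sum>l\<in>S. (- 1 / c j) * (c l * A $$ (r, l)))"
          using A S r by (intro sum.cong) auto
        also have "\<dots> = (- 1 / c j) * (\<Sum>l\<in>S. c l * A $$ (r, l))"
          by (simp add: sum_distrib_left)
        also have "\<dots> = A $$ (r, j)"
          using eq[OF r] cj by (simp add: field_simps)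
        finally show ?thesis using A r j by simp
      qed
      then have "col A j = vec m (\<lambda>r. \<Sum>l\<in>S. (- c l / c j) * col A l $ r)"
        using A by auto
      then show False using V.sum_in_span[OF fin U(2), of "col A" "\<lambda>l. - c l / c j"] j(2) by simp
    qed
    moreover from this have "\<forall>l\<in>S. c l = 0"
      using eq pos unfolding vol_col_submatrix_pos_iff[OF A S] by simp
    ultimately show "\<forall>l\<in>insert j S. c l = 0" by simp
  qed
  then show thesis using that j \<open>j \<notin> S\<close> by blast
qed

section \<open>Rank-one updates that preserve the product with \<open>X\<close>\<close>

lemma exists_left_null_vector:
  fixes X :: "real mat"
  assumes X: "X \<in> carrier_mat n q" and "q < n"
  obtains z p where "p < n" "z p \<noteq> 0" "\<And>l. l < q \<Longrightarrow> (\<Sum>i<n. z i * X $$ (i, l)) = 0"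
proof -
  \<comment> \<open>\<open>Z\<close> is the transpose of \<open>X\<close> padded with zero rows to a
    square matrix. Because q < n, row \<open>q\<close> is one of the padding rows, so the
    determinant is 0 and a nonzero kernel vector exists.\<close>
  define Z where "Z = mat\<^sub>r n n (\<lambda>i. if i = q then 0\<^sub>v n else
    vec n (\<lambda>j. if i < q then X $$ (j, i) else 0))"
  have Z: "Z \<in> carrier_mat n n" by (simp add: Z_def)
  have "det Z = 0" unfolding Z_def
    by (rule det_row_0) (use assms in auto)
  then obtain v where v: "v \<in> carrier_vec n" "v \<noteq> 0\<^sub>v n" "Z *\<^sub>v v = 0\<^sub>v n"
    using det_0_iff_vec_prod_zero_field[OF Z] by blast
  obtain p where p: "p < n" "v $ p \<noteq> 0" using v by (metis carrier_vecD eq_vecI index_zero_vec)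
  have "(\<Sum>i<n. v $ i * X $$ (i, l)) = 0" if l: "l < q" for l
  proof -
    have "(Z *\<^sub>v v) $ l = (\<Sum>i<n. v $ i * X $$ (i, l))"
      using l assms(2) v(1)
      by (simp add: Z_def scalar_prod_def atLeast0LessThan) (simp add: mult.commute)
    moreover have "(Z *\<^sub>v v) $ l = 0" using v(3) l assms(2) by simp
    ultimately show ?thesis by simp
  qed
  with p show thesis using that[of p "\<lambda>i. v $ i"] by blast
qed

definition rank_one_update :: "real mat \<Rightarrow> (nat \<Rightarrow> real) \<Rightarrow> (nat \<Rightarrow> real) \<Rightarrow> real mat" where
  "rank_one_update A u z = mat (dim_row A) (dim_col A) (\<lambda>(r, l). A $$ (r, l) + u r * z l)"

lemma rank_one_update_carrier:
  "A \<in> carrier_mat m n \<Longrightarrow> rank_one_update A u z \<in> carrier_mat m n"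
  by (auto simp: rank_one_update_def)

lemma rank_one_update_index:
  "A \<in> carrier_mat m n \<Longrightarrow> r < m \<Longrightarrow> l < n \<Longrightarrow>
    rank_one_update A u z $$ (r, l) = A $$ (r, l) + u r * z l"
  by (auto simp: rank_one_update_def)

lemma rank_one_update_mult:
  assumes A: "A \<in> carrier_mat m n" and X: "X \<in> carrier_mat n q"
    and z: "\<And>l. l < q \<Longrightarrow> (\<Sum>i<n. z i * X $$ (i, l)) = 0"
  shows "rank_one_update A u z * X = A * X"
proof (rule eq_matI)
  fix r l assume "r < dim_row (A * X)" "l < dim_col (A * X)"
  then have r: "r < m" and l: "l < q" using A X by auto
  have "(rank_one_update A u z * X) $$ (r, l)
      = (\<Sum>i<n. (A $$ (r, i) + u r * z i) * X $$ (i, l))"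
    using r l A X
    by (simp add: rank_one_update_def scalar_prod_def atLeast0LessThan)
  also have "\<dots> = (\<Sum>i<n. A $$ (r, i) * X $$ (i, l)) + u r * (\<Sum>i<n. z i * X $$ (i, l))"
    by (simp add: sum_distrib_left sum.distrib algebra_simps)
  also have "\<dots> = (A * X) $$ (r, l)"
    using r l A X z[OF l] by (simp add: scalar_prod_def atLeast0LessThan)
  finally show "(rank_one_update A u z * X) $$ (r, l) = (A * X) $$ (r, l)" .
qed (use A X in \<open>auto simp: rank_one_update_def\<close>)

section \<open>The two perturbations and the resulting improving swaps\<close>

text \<open>The update subtracts z_l / z_p times column \<open>p\<close> from each column
  \<open>l\<close>. It turns column \<open>p\<close> into zero, and changes the others only by
  multiples of the old column \<open>p\<close>, which is independent of the remaining columns of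
  \<open>insert j S\<close>.\<close>

lemma kill_column_update:
  assumes A: "A \<in> carrier_mat m n" and S: "S \<subseteq> {..<n}" and p: "p \<in> S" "z p \<noteq> 0"
    and j: "j \<in> {..<n} - S" "0 < vol (col_submatrix A (insert j S))"
  defines "B \<equiv> rank_one_update A (\<lambda>r. - A $$ (r, p) / z p) z"
  shows "vol (col_submatrix B S) = 0" "0 < vol (col_submatrix B (insert j (S - {p})))"
proof -
  have B: "B \<in> carrier_mat m n" unfolding B_def by (rule rank_one_update_carrier[OF A])
  have fin: "finite S" using S finite_subset by blast
  have idx: "B $$ (r, l) = A $$ (r, l) - z l / z p * A $$ (r, p)" if "r < m" "l < n" for r l
    unfolding B_def by (simp add: rank_one_update_index[OF A that])
  have "(\<Sum>l\<in>S. of_bool (l = p) * B $$ (r, l)) = 0" if "r < m" for r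
    using that p S by (intro sum.neutral) (auto simp: idx subset_iff)
  then have "\<not> 0 < vol (col_submatrix B S)"
    unfolding vol_col_submatrix_pos_iff[OF B S] using p
    by (auto intro!: exI[of _ "\<lambda>l. of_bool (l = p)"])
  then show "vol (col_submatrix B S) = 0" using vol_nonneg[of "col_submatrix B S"] by simp
  define T where "T = insert j (S - {p})"
  have T: "T \<subseteq> {..<n}" "finite T" "p \<notin> T" "insert j S = insert p T" "insert p T \<subseteq> {..<n}"
    using S j p fin by (auto simp: T_def)
  show "0 < vol (col_submatrix B (insert j (S - {p})))"
    unfolding T_def[symmetric] vol_col_submatrix_pos_iff[OF B T(1)]
  proof (intro allI impI)
    fix c assume c: "\<forall>r<m. (\<Sum>l\<in>T. c l * B $$ (r, l)) = 0"
    \<comment> \<open>\<open>s\<close> collects all multiples of column \<open>p\<close> that the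
      update subtracts, so a relation among the columns of \<open>B\<close> in \<open>T\<close>
      becomes one of \<open>A\<close> on \<open>insert p T\<close>, with coefficient
      \<open>- s\<close> at \<open>p\<close>.\<close>
    define s where "s = (\<Sum>l\<in>T. c l * (z l / z p))"
    let ?c = "c(p := - s)"
    have "(\<Sum>l\<in>insert p T. ?c l * A $$ (r, l)) = 0" if r: "r < m" for r
    proof -
      have "(\<Sum>l\<in>insert p T. ?c l * A $$ (r, l)) = (\<Sum>l\<in>T. ?c l * A $$ (r, l)) - s * A $$ (r, p)"
        using T by simp
      also have "(\<Sum>l\<in>T. ?c l * A $$ (r, l)) = (\<Sum>l\<in>T. c l * A $$ (r, l))"
        using T by (intro sum.cong) auto
      also have "\<dots> - s * A $$ (r, p) = (\<Sum>l\<in>T. c l * B $$ (r, l))"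
        unfolding s_def sum_distrib_right sum_subtractf[symmetric]
        using T r by (intro sum.cong) (auto simp: idx algebra_simps subset_iff)
      finally show ?thesis using c r by simp
    qed
    then have "\<forall>l\<in>insert p T. ?c l = 0"
      using j(2) unfolding T(4) vol_col_submatrix_pos_iff[OF A T(5)] by blast
    then show "\<forall>l\<in>T. c l = 0" using T by (metis fun_upd_other insertCI)
  qed
qed

lemma scale_column_update:
  assumes A: "A \<in> carrier_mat m n" and S: "S \<subseteq> {..<n}"
    and z: "\<And>l. l \<in> S \<Longrightarrow> z l = 0" "p < n" "z p \<noteq> 0"
    and j: "j \<in> {..<n} - S" "0 < vol (col_submatrix A (insert j S))" and i: "i \<in> S"
  obtains u where "vol (col_submatrix (rank_one_update A u z) S) = vol (col_submatrix A S)"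
    "K < vol (col_submatrix (rank_one_update A u z) (insert p (S - {i})))"
proof -
  have fin: "finite S" using S finite_subset by blast
  have "p \<notin> S" using z by auto
  define T where "T = insert p (S - {i})"
  have T: "T \<subseteq> {..<n}" "p \<in> T" "finite T" "p \<notin> S - {i}"
    using S z(2) fin \<open>p \<notin> S\<close> by (auto simp: T_def)
  \<comment> \<open>\<open>C\<close> is \<open>A\<close> with column \<open>p\<close> replaced by
    column \<open>j\<close>; p = j is possible. On \<open>T\<close> the final matrix will be
    \<open>C\<close> with column \<open>p\<close> scaled, so its volume can be read off from that of
    \<open>C\<close>.\<close>
  define C where "C = mat m n (\<lambda>(r, l). A $$ (r, if l = p then j else l))"
  have C: "C \<in> carrier_mat m n" by (simp add: C_def)
  have posC: "0 < vol (col_submatrix C T)"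
    unfolding vol_col_submatrix_pos_iff[OF C T(1)]
  proof (intro allI impI)
    fix c assume c: "\<forall>r<m. (\<Sum>l\<in>T. c l * C $$ (r, l)) = 0"
    \<comment> \<open>A relation on \<open>T\<close> becomes a relation of \<open>A\<close> on
      \<open>insert j S\<close>: the coefficient at \<open>p\<close> moves to \<open>j\<close>, and
      the removed index \<open>i\<close> gets 0.\<close>
    let ?c = "\<lambda>l. if l = j then c p else if l = i then 0 else c l"
    have jS: "insert j S \<subseteq> {..<n}" using S j by auto
    have sum0: "(\<Sum>l\<in>insert j S. ?c l * A $$ (r, l)) = 0" if r: "r < m" for r
    proof -
      have "(\<Sum>l\<in>insert j S. ?c l * A $$ (r, l))
          = c p * A $$ (r, j) + (\<Sum>l\<in>S. ?c l * A $$ (r, l))"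
        using fin j by simp
      also have "(\<Sum>l\<in>S. ?c l * A $$ (r, l)) = (\<Sum>l\<in>S - {i}. ?c l * A $$ (r, l))"
        using fin i j by (subst sum.remove[of _ i]) auto
      also have "\<dots> = (\<Sum>l\<in>S - {i}. c l * C $$ (r, l))"
        using j(1) S r \<open>p \<notin> S\<close> by (intro sum.cong) (auto simp: C_def subset_iff)
      also have "c p * A $$ (r, j) + \<dots> = (\<Sum>l\<in>T. c l * C $$ (r, l))"
        unfolding T_def using fin T(4) r z(2) by (simp add: C_def)
      finally show ?thesis using c r by simp
    qed
    have "\<forall>l\<in>insert j S. ?c l = 0"
      by (rule mp[OF spec[OF j(2)[unfolded vol_col_submatrix_pos_iff[OF A jS]], of ?c]],
          intro allI impI, rule sum0)
    then show "\<forall>l\<in>T. c l = 0"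
      using j by (auto simp: T_def split: if_splits)
  qed
  \<comment> \<open>Chosen so that \<open>a\<close> times the volume of the \<open>T\<close>-columns
    of \<open>C\<close> is |K| plus that volume, hence above \<open>K\<close>.\<close>
  define a where "a = \<bar>K\<bar> / vol (col_submatrix C T) + 1"
  \<comment> \<open>Solves a_p + z_p u = a a_j, where a_p and a_j are columns of
    \<open>A\<close>.\<close>
  define u where "u r = (a * A $$ (r, j) - A $$ (r, p)) / z p" for r
  define B where "B = rank_one_update A u z"
  have B: "B \<in> carrier_mat m n" unfolding B_def by (rule rank_one_update_carrier[OF A])
  have BS: "B $$ (r, l) = A $$ (r, l)" if "r < m" "l \<in> S" for r l
    unfolding B_def using that S z(1) by (simp add: rank_one_update_index[OF A] subset_iff)
  have aC: "multcol p a C \<in> carrier_mat m n" using C by auto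
  have "col_submatrix B T = col_submatrix (multcol p a C) T"
  proof (rule col_submatrix_cong[OF B aC T(1)])
    fix r l assume r: "r < m" and l: "l \<in> T"
    show "B $$ (r, l) = multcol p a C $$ (r, l)"
    proof (cases "l = p")
      case True
      then show ?thesis
        using r z j by (simp add: B_def rank_one_update_index[OF A] C_def u_def)
    next
      case False
      then show ?thesis
        using r l T(1) by (auto simp: BS T_def C_def)
    qed
  qed
  then have "vol (col_submatrix B T) = \<bar>a\<bar> * vol (col_submatrix C T)"
    by (simp add: vol_col_submatrix_multcol[OF C T(1,2)])
  also have "\<dots> = \<bar>K\<bar> + vol (col_submatrix C T)"
    using posC by (simp add: a_def field_simps)
  also have "\<dots> > K" using posC by simp
  finally have "K < vol (col_submatrix B T)" .
  moreover have "col_submatrix B S = col_submatrix A S"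
    by (rule col_submatrix_cong[OF B A S]) (rule BS)
  ultimately show thesis using that[of u] unfolding B_def T_def by simp
qed

theorem proposition6p1:
  fixes m n q k :: nat and A X :: "real mat" and S :: "nat set"
  assumes "k \<ge> 1"
    and "A \<in> carrier_mat m n"
    and "mat_rank A > k"
    and "X \<in> carrier_mat n q"
    and "mat_rank X = q"
    and "q \<le> n - 1"
    and "S \<subseteq> {..<n}"
    and "card S = k"
    and "vol (col_submatrix A S) > 0"
  shows "\<forall>\<gamma>::real. \<gamma> \<ge> 1 \<longrightarrow>
    (\<exists>B \<in> carrier_mat m n. B \<noteq> A \<and> B * X = A * X \<and>
       \<not> local_max_vol_subset k \<gamma> B S \<and>
       (\<exists>T \<in> one_swap_nbhd n S.
          vol (col_submatrix B T) > \<gamma> * vol (col_submatrix B S)))"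
proof (intro allI impI)
  fix \<gamma> :: real
  assume "\<gamma> \<ge> 1"
  note A = assms(2) and X = assms(4) and S = assms(7)
  have "S \<noteq> {}" using assms(1,8) by auto
  \<comment> \<open>A nonempty \<open>S\<close> forces n > 0, so the truncated subtraction in
    \<open>n - 1\<close> is harmless.\<close>
  then have "q < n" using S assms(6) by auto
  obtain z p where z: "p < n" "z p \<noteq> 0" "\<And>l. l < q \<Longrightarrow> (\<Sum>i<n. z i * X $$ (i, l)) = 0"
    using exists_left_null_vector[OF X \<open>q < n\<close>] by blast
  obtain j where j: "j \<in> {..<n} - S" "0 < vol (col_submatrix A (insert j S))"
    using obtain_col_extending_basis[OF A S _ assms(9)] assms(3,8) by blast
  have "\<exists>u T. rank_one_update A u z \<noteq> A \<and> T \<in> one_swap_nbhd n S \<and>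
    vol (col_submatrix (rank_one_update A u z) T)
      > \<gamma> * vol (col_submatrix (rank_one_update A u z) S)"
  proof (cases "\<exists>i\<in>S. z i \<noteq> 0")
    case True
    then obtain i where i: "i \<in> S" "z i \<noteq> 0" by blast
    have "insert j (S - {i}) \<in> one_swap_nbhd n S"
      using i j unfolding one_swap_nbhd_def by blast
    \<comment> \<open>The updated matrix differs from \<open>A\<close> because the volume on
      \<open>S\<close> drops from positive to 0; any positive volume then beats \<gamma> times
      it.\<close>
    then show ?thesis
      using kill_column_update[where z = z, OF A S i j] assms(9)
      by (intro exI[of _ "\<lambda>r. - A $$ (r, i) / z i"] exI[of _ "insert j (S - {i})"])
        (metis less_irrefl mult_zero_right)
  next
    case False
    obtain i where i: "i \<in> S" using \<open>S \<noteq> {}\<close> by blast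
    let ?T = "insert p (S - {i})"
    \<comment> \<open>The first entry of the maximum gives the required gap. The second makes the
      volume on \<open>?T\<close> differ from that for \<open>A\<close>, so the update is not
      \<open>A\<close> itself.\<close>
    obtain u where u: "vol (col_submatrix (rank_one_update A u z) S) = vol (col_submatrix A S)"
      "max (\<gamma> * vol (col_submatrix A S)) (vol (col_submatrix A ?T))
        < vol (col_submatrix (rank_one_update A u z) ?T)"
      using scale_column_update[where z = z, OF A S _ z(1,2) j i] False by blast
    have "?T \<in> one_swap_nbhd n S"
      using i z False unfolding one_swap_nbhd_def by blast
    with u show ?thesis by (intro exI[of _ u] exI[of _ ?T]) auto
  qed
  then obtain u T where uT: "rank_one_update A u z \<noteq> A" "T \<in> one_swap_nbhd n S"
    "vol (col_submatrix (rank_one_update A u z) T)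
      > \<gamma> * vol (col_submatrix (rank_one_update A u z) S)" by blast
  let ?B = "rank_one_update A u z"
  have B: "?B \<in> carrier_mat m n" by (rule rank_one_update_carrier[OF A])
  have "\<not> local_max_vol_subset k \<gamma> ?B S"
    using uT B unfolding local_max_vol_subset_def by (auto simp: not_le)
  then show "\<exists>B \<in> carrier_mat m n. B \<noteq> A \<and> B * X = A * X \<and>
       \<not> local_max_vol_subset k \<gamma> B S \<and>
       (\<exists>T \<in> one_swap_nbhd n S.
          vol (col_submatrix B T) > \<gamma> * vol (col_submatrix B S))"
    using uT B rank_one_update_mult[OF A X z(3)] by blast
qed

end
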